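(* Let $(\alpha,\beta)$ and $(\alpha',\beta')\in K^2$. The following assertions are equivalent: 1. $\mathcal{A}_{N,\alpha,\beta}=\mathcal{A}_{N,\alpha',\beta'}$. 2. $\mathcal{A}_{\alpha,\beta}=\mathcal{A}_{\alpha',\beta'}$. 3. ($\beta=\beta'$ and $\alpha\alpha'\neq0$) or ($\alpha=\alpha'=0$).
   Context: $K$ is a field of characteristic zero. A rooted tree is a finite connected graph without cycles with a distinguished root (up to isomorphism); a planar rooted tree is a rooted tree with an embedding in the plane; the weight is the number of vertices; $\bullet$ is the tree of weight $1$. $\mathcal{H}_{CK}$ is the free commutative unital $K$-algebra generated by rooted trees; $\mathcal{H}_{NCK}$ is the free associative unital $K$-algebra generated by planar rooted trees; both are graded by weight, and the completion of a graded algebra is the product of its homogeneous components. $B^+$ is the linear (continuous) operator sending a forest to the tree obtained by grafting its trees (in order, in the planar case) on a common new root, $B^+(1)=\bullet$. For $(\alpha,\beta)\in K^2$, $P_{\alpha,\beta}\in K[[h]]$ is the unique solution of $(1-\alpha\beta h)P'(h)=\alpha P(h)$, $P(0)=1$. Let $\sum_{n\ge1}a_n(\alpha,\beta)\in\overline{\mathcal{H}_{CK}}$ and $\sum_{n\ge1}\mathbf{a}_n(\alpha,\beta)\in\overline{\mathcal{H}_{NCK}}$ (with $a_n$, $\mathbf{a}_n$ homogeneous of degree $n$) be the unique solutions of the equation $X=B^+(P_{\alpha,\beta}(X))$ in $\overline{\mathcal{H}_{CK}}$ and $\overline{\mathcal{H}_{NCK}}$ respectively, where $P(X)=\sum_k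 p_kX^k$ for $P=\sum_k p_kh^k$. $\mathcal{A}_{\alpha,\beta}$ is the unital subalgebra of $\mathcal{H}_{CK}$ generated by the $a_n(\alpha,\beta)$, $n\ge1$, and $\mathcal{A}_{N,\alpha,\beta}$ is the unital subalgebra of $\mathcal{H}_{NCK}$ generated by the $\mathbf{a}_n(\alpha,\beta)$, $n\ge1$. *)

theory Defs
  imports
    "HOL-Library.Poly_Mapping"
    "HOL-Library.Multiset"
    "HOL-Computational_Algebra.Formal_Power_Series"
begin

text \<open>
  A rooted tree up to isomorphism is determined by the finite multiset of the subtrees hanging from
  its root; a planar rooted tree by the finite list of these subtrees, read from left to right.
\<close>

datatype rtree = RNode "rtree multiset"

datatype ptree = PNode "ptree list"

primrec rtree_weight :: "rtree \<Rightarrow> nat" where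
  "rtree_weight (RNode F) = Suc (\<Sum>t\<in>#F. rtree_weight t)"

primrec ptree_weight :: "ptree \<Rightarrow> nat" where
  "ptree_weight (PNode F) = Suc (sum_list (map ptree_weight F))"

definition rforest_weight :: "rtree multiset \<Rightarrow> nat" where
  "rforest_weight F = (\<Sum>t\<in>#F. rtree_weight t)"

definition pforest_weight :: "ptree list \<Rightarrow> nat" where
  "pforest_weight F = sum_list (map ptree_weight F)"

text \<open>
  The free monoid, written additively, because the monoid algebra of \<^typ>\<open>'m\<close> over
  \<^typ>\<open>'k\<close> is the type \<open>'m \<Rightarrow>\<^sub>0 'k\<close>, which convolves along
  addition. (Multisets carry the free commutative monoid structure already.)
\<close>

instantiation list :: (type) monoid_add
begin

definition zero_list :: "'a list" where "zero_list = []"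

definition plus_list :: "'a list \<Rightarrow> 'a list \<Rightarrow> 'a list" where "plus_list = append"

instance by standard (simp_all add: zero_list_def plus_list_def)

end

text \<open>
  The free commutative algebra on rooted trees and the free associative algebra on planar rooted
  trees, as monoid algebras with the forests as basis.
\<close>

type_synonym 'k HCK = "rtree multiset \<Rightarrow>\<^sub>0 'k"

type_synonym 'k HNCK = "ptree list \<Rightarrow>\<^sub>0 'k"

definition scalar :: "'k::semiring_1 \<Rightarrow> ('m::monoid_add \<Rightarrow>\<^sub>0 'k)" where
  "scalar c = Poly_Mapping.single 0 c"

definition subalgebra :: "('m::monoid_add \<Rightarrow>\<^sub>0 'k::semiring_1) set \<Rightarrow> bool" where
  "subalgebra S \<longleftrightarrow>
     1 \<in> S \<and> (\<forall>x\<in>S. \<forall>y\<in>S. x + y \<in> S) \<and> (\<forall>x\<in>S. \<forall>y\<in>S. x * y \<in> S) \<and>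
     (\<forall>c. \<forall>x\<in>S. scalar c * x \<in> S)"

definition homogeneous :: "('m \<Rightarrow> nat) \<Rightarrow> nat \<Rightarrow> ('m \<Rightarrow>\<^sub>0 'k::zero) set" where
  "homogeneous wt n = {f. \<forall>F\<in>Poly_Mapping.keys f. wt F = n}"

text \<open>
  The product of the homogeneous components of a graded algebra \<open>H\<close>: the family
  \<open>(x\<^sub>n)\<close>, written \<open>\<Sum>\<^sub>n x\<^sub>n\<close>, is the formal power series over
  \<open>H\<close> with coefficients \<open>x\<^sub>n\<close>, so that the product of the completion is
  that of formal power series.
\<close>

definition completion :: "('m \<Rightarrow> nat) \<Rightarrow> ('m \<Rightarrow>\<^sub>0 'k::zero) fps set" where
  "completion wt = {X. \<forall>n. fps_nth X n \<in> homogeneous wt n}"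

text \<open>
  Here \<open>graft F\<close> is the forest consisting of the single tree obtained by grafting the trees
  of \<open>F\<close> on a common new root.
\<close>

definition bplus :: "('m \<Rightarrow> 'm) \<Rightarrow> ('m \<Rightarrow>\<^sub>0 'k::comm_monoid_add) \<Rightarrow> ('m \<Rightarrow>\<^sub>0 'k)" where
  "bplus graft f =
     (\<Sum>F\<in>Poly_Mapping.keys f. Poly_Mapping.single (graft F) (Poly_Mapping.lookup f F))"

text \<open>
  The continuous extension of \<^const>\<open>bplus\<close>, which is homogeneous of degree 1.
\<close>

definition bplus_hat ::
    "('m \<Rightarrow> 'm) \<Rightarrow> ('m \<Rightarrow>\<^sub>0 'k::comm_monoid_add) fps \<Rightarrow> ('m \<Rightarrow>\<^sub>0 'k) fps" where
  "bplus_hat graft X =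
     Abs_fps (\<lambda>n. case n of 0 \<Rightarrow> 0 | Suc m \<Rightarrow> bplus graft (fps_nth X m))"

text \<open>
  \<open>P(X) = \<Sum>\<^sub>k p\<^sub>k X\<^sup>k\<close>, meaningful if \<open>X\<close> has no component in
  degree 0.
\<close>

definition fps_subst ::
    "'k::semiring_1 fps \<Rightarrow> ('m::monoid_add \<Rightarrow>\<^sub>0 'k) fps \<Rightarrow> ('m \<Rightarrow>\<^sub>0 'k) fps" where
  "fps_subst P X = fps_compose (Abs_fps (\<lambda>k. scalar (fps_nth P k))) X"

definition P_eq :: "'k::field_char_0 \<Rightarrow> 'k \<Rightarrow> 'k fps \<Rightarrow> bool" where
  "P_eq \<alpha> \<beta> P \<longleftrightarrow>
     (1 - fps_const (\<alpha> * \<beta>) * fps_X) * fps_deriv P = fps_const \<alpha> * P \<and> fps_nth P 0 = 1"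

definition P_series :: "'k::field_char_0 \<Rightarrow> 'k \<Rightarrow> 'k fps" where
  "P_series \<alpha> \<beta> = (THE P. P_eq \<alpha> \<beta> P)"

definition DSE ::
    "('m \<Rightarrow> nat) \<Rightarrow> ('m \<Rightarrow> 'm) \<Rightarrow> 'k::semiring_1 fps \<Rightarrow> ('m::monoid_add \<Rightarrow>\<^sub>0 'k) fps \<Rightarrow> bool" where
  "DSE wt graft P X \<longleftrightarrow>
     X \<in> completion wt \<and> fps_nth X 0 = 0 \<and> X = bplus_hat graft (fps_subst P X)"

definition rgraft :: "rtree multiset \<Rightarrow> rtree multiset" where
  "rgraft F = {#RNode F#}"

definition pgraft :: "ptree list \<Rightarrow> ptree list" where
  "pgraft F = [PNode F]"

definition a_CK :: "'k::field_char_0 \<Rightarrow> 'k \<Rightarrow> nat \<Rightarrow> 'k HCK" where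
  "a_CK \<alpha> \<beta> n = fps_nth (THE X. DSE rforest_weight rgraft (P_series \<alpha> \<beta>) X) n"

definition a_NCK :: "'k::field_char_0 \<Rightarrow> 'k \<Rightarrow> nat \<Rightarrow> 'k HNCK" where
  "a_NCK \<alpha> \<beta> n = fps_nth (THE X. DSE pforest_weight pgraft (P_series \<alpha> \<beta>) X) n"

definition A_CK :: "'k::field_char_0 \<Rightarrow> 'k \<Rightarrow> 'k HCK set" where
  "A_CK \<alpha> \<beta> = subalgebra hull {a_CK \<alpha> \<beta> n |n. n \<ge> 1}"

definition A_NCK :: "'k::field_char_0 \<Rightarrow> 'k \<Rightarrow> 'k HNCK set" where
  "A_NCK \<alpha> \<beta> = subalgebra hull {a_NCK \<alpha> \<beta> n |n. n \<ge> 1}"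

text \<open>
  The definite descriptions above are justified: the equations have unique solutions.
\<close>

lemma P_eq_iff:
  "P_eq \<alpha> \<beta> P \<longleftrightarrow> fps_nth P 0 = 1 \<and>
     (\<forall>n. of_nat (Suc n) * fps_nth P (Suc n) = (\<alpha> + \<alpha> * \<beta> * of_nat n) * fps_nth P n)"
proof -
  have "(1 - fps_const (\<alpha> * \<beta>) * fps_X) * fps_deriv P = fps_const \<alpha> * P \<longleftrightarrow>
     (\<forall>n. of_nat (Suc n) * fps_nth P (Suc n) = (\<alpha> + \<alpha> * \<beta> * of_nat n) * fps_nth P n)"
    unfolding fps_eq_iff
  proof (rule all_cong1)
    fix n
    show "fps_nth ((1 - fps_const (\<alpha> * \<beta>) * fps_X) * fps_deriv P) n = fps_nth (fps_const \<alpha> * P) n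
        \<longleftrightarrow> of_nat (Suc n) * fps_nth P (Suc n) = (\<alpha> + \<alpha> * \<beta> * of_nat n) * fps_nth P n"
      by (cases n) (auto simp: algebra_simps)
  qed
  then show ?thesis
    by (auto simp: P_eq_def)
qed

lemma P_eq_ex1: "\<exists>!P. P_eq \<alpha> \<beta> P"
proof (rule ex_ex1I)
  define p where "p = rec_nat 1 (\<lambda>n c. (\<alpha> + \<alpha> * \<beta> * of_nat n) * c / of_nat (Suc n))"
  have "of_nat (Suc n) * p (Suc n) = (\<alpha> + \<alpha> * \<beta> * of_nat n) * p n" for n
    unfolding p_def by (simp del: of_nat_Suc)
  moreover have "p 0 = 1"
    by (simp add: p_def)
  ultimately show "\<exists>P. P_eq \<alpha> \<beta> P"
    by (intro exI[of _ "Abs_fps p"]) (simp add: P_eq_iff del: of_nat_Suc)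
next
  fix P Q
  assume P: "P_eq \<alpha> \<beta> P" and Q: "P_eq \<alpha> \<beta> Q"
  have "fps_nth P n = fps_nth Q n" for n
  proof (induction n)
    case 0
    then show ?case using P Q by (simp add: P_eq_iff)
  next
    case (Suc n)
    then have "of_nat (Suc n) * fps_nth P (Suc n) = of_nat (Suc n) * fps_nth Q (Suc n)"
      using P Q by (simp add: P_eq_iff del: of_nat_Suc)
    then show ?case
      by (simp del: of_nat_Suc)
  qed
  then show "P = Q"
    by (simp add: fps_eq_iff)
qed

lemma fps_power_nth_cong:
  fixes X Y :: "'a::semiring_1 fps"
  assumes "\<And>i. i \<le> n \<Longrightarrow> fps_nth X i = fps_nth Y i" "m \<le> n"
  shows "fps_nth (X ^ k) m = fps_nth (Y ^ k) m"
  using assms(2)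
proof (induction k arbitrary: m)
  case (Suc k)
  then show ?case
    using assms(1) by (auto simp: fps_mult_nth intro!: sum.cong)
qed simp

lemma dse_step_cong:
  assumes "\<And>i. i < n \<Longrightarrow> fps_nth X i = fps_nth Y i"
  shows "fps_nth (bplus_hat graft (fps_subst P X)) n = fps_nth (bplus_hat graft (fps_subst P Y)) n"
proof (cases n)
  case (Suc m)
  have "fps_nth (X ^ k) m = fps_nth (Y ^ k) m" for k
    by (rule fps_power_nth_cong[of m]) (use assms Suc in auto)
  then show ?thesis
    by (simp add: Suc bplus_hat_def fps_subst_def fps_compose_nth)
qed (simp add: bplus_hat_def)

lemma homogeneous_zero: "0 \<in> homogeneous wt n"
  by (simp add: homogeneous_def)

lemma homogeneous_add:
  "x \<in> homogeneous wt n \<Longrightarrow> y \<in> homogeneous wt n \<Longrightarrow> x + y \<in> homogeneous wt n"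
  unfolding homogeneous_def using Poly_Mapping.keys_add[of x y] by blast

lemma homogeneous_sum:
  "(\<And>i. i \<in> I \<Longrightarrow> f i \<in> homogeneous wt n) \<Longrightarrow> sum f I \<in> homogeneous wt n"
  by (induction I rule: infinite_finite_induct) (auto simp: homogeneous_zero homogeneous_add)

lemma homogeneous_mult:
  assumes "\<And>F G. wt (F + G) = wt F + wt G"
    and "x \<in> homogeneous wt m" "y \<in> homogeneous wt n"
  shows "x * y \<in> homogeneous wt (m + n)"
  using assms Poly_Mapping.keys_mult[of x y] by (fastforce simp: homogeneous_def)

lemma homogeneous_scalar: "wt 0 = 0 \<Longrightarrow> scalar c \<in> homogeneous wt 0"
  by (simp add: homogeneous_def scalar_def)

lemma homogeneous_bplus:
  assumes "\<And>F. wt (graft F) = Suc (wt F)" "x \<in> homogeneous wt n"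
  shows "bplus graft x \<in> homogeneous wt (Suc n)"
  unfolding bplus_def using assms by (intro homogeneous_sum) (auto simp: homogeneous_def)

lemma completion_power:
  fixes X :: "('m::monoid_add \<Rightarrow>\<^sub>0 'k::semiring_1) fps"
  assumes "wt 0 = 0" "\<And>F G. wt (F + G) = wt F + wt G" "X \<in> completion wt"
  shows "X ^ k \<in> completion wt"
proof (induction k)
  case 0
  then show ?case
    using assms(1) by (auto simp: completion_def homogeneous_def)
next
  case (Suc k)
  have "fps_nth X i * fps_nth (X ^ k) (n - i) \<in> homogeneous wt n" if "i \<le> n" for i n
    using homogeneous_mult[of wt "fps_nth X i" i "fps_nth (X ^ k) (n - i)" "n - i"] assms Suc that
    by (simp add: completion_def)
  then show ?case
    by (auto simp: completion_def fps_mult_nth intro!: homogeneous_sum)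
qed

lemma completion_dse_step:
  fixes X :: "('m::monoid_add \<Rightarrow>\<^sub>0 'k::semiring_1) fps"
  assumes "wt 0 = 0" "\<And>F G. wt (F + G) = wt F + wt G" "\<And>F. wt (graft F) = Suc (wt F)"
    and "X \<in> completion wt"
  shows "bplus_hat graft (fps_subst P X) \<in> completion wt"
proof -
  have "scalar c * fps_nth (X ^ k) n \<in> homogeneous wt n" for c k n
    using homogeneous_mult[of wt "scalar c" 0 "fps_nth (X ^ k) n" n] homogeneous_scalar[of wt c]
      completion_power[of wt X k] assms
    by (simp add: completion_def)
  then have "fps_nth (fps_subst P X) n \<in> homogeneous wt n" for n
    by (auto simp: fps_subst_def fps_compose_nth intro!: homogeneous_sum)
  then show ?thesis
    using assms(3)
    by (auto simp: completion_def bplus_hat_def homogeneous_zero homogeneous_bplus split: nat.split)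
qed

lemma DSE_ex1:
  fixes wt :: "'m::monoid_add \<Rightarrow> nat" and P :: "'k::semiring_1 fps"
  assumes wt: "wt 0 = 0" "\<And>F G. wt (F + G) = wt F + wt G" "\<And>F. wt (graft F) = Suc (wt F)"
  shows "\<exists>!X. DSE wt graft P X"
proof (rule ex_ex1I)
  define T where "T = (\<lambda>X. bplus_hat graft (fps_subst P X))"
  define Z where "Z = (\<lambda>m. (T ^^ m) 0)"
  have cong: "fps_nth (T X) n = fps_nth (T Y) n"
    if "\<And>i. i < n \<Longrightarrow> fps_nth X i = fps_nth Y i" for X Y n
    unfolding T_def using that by (rule dse_step_cong)
  have ZS: "Z (Suc m) = T (Z m)" for m
    by (simp add: Z_def)
  have step: "fps_nth (Z m) n = fps_nth (Z (Suc m)) n" if "n < m" for m n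
    using that
  proof (induction m arbitrary: n)
    case (Suc m)
    have "fps_nth (T (Z m)) n = fps_nth (T (Z (Suc m))) n"
      by (rule cong, rule Suc.IH) (use Suc.prems in linarith)
    then show ?case
      by (simp only: ZS)
  qed simp
  have stable: "fps_nth (Z m) n = fps_nth (Z (Suc n)) n" if "Suc n \<le> m" for m n
    using that
  proof (induction m rule: dec_induct)
    case (step m)
    then show ?case
      using \<open>\<And>m n. n < m \<Longrightarrow> fps_nth (Z m) n = fps_nth (Z (Suc m)) n\<close>[of n m]
      by (metis Suc_le_lessD)
  qed (rule refl)
  have Zc: "Z m \<in> completion wt" for m
  proof (induction m)
    case 0
    then show ?case by (simp add: Z_def completion_def homogeneous_zero)
  next
    case (Suc m)
    then show ?case unfolding ZS T_def by (intro completion_dse_step wt)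
  qed
  define X where "X = Abs_fps (\<lambda>n. fps_nth (Z (Suc n)) n)"
  have "fps_nth (T X) n = fps_nth X n" for n
  proof -
    have "fps_nth (T X) n = fps_nth (T (Z n)) n"
    proof (rule cong)
      fix i
      assume "i < n"
      then show "fps_nth X i = fps_nth (Z n) i"
        using stable[of i n] by (simp only: X_def fps_nth_Abs_fps Suc_le_eq)
    qed
    then show ?thesis
      by (simp add: X_def ZS)
  qed
  then have "X = T X"
    by (simp add: fps_eq_iff)
  moreover have "X \<in> completion wt"
    using Zc by (simp add: X_def completion_def)
  moreover have "fps_nth X 0 = 0"
    by (simp add: X_def ZS T_def bplus_hat_def)
  ultimately show "\<exists>X. DSE wt graft P X"
    by (auto simp: DSE_def T_def)
next
  fix X Y
  assume X: "DSE wt graft P X" and Y: "DSE wt graft P Y"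
  have "fps_nth X n = fps_nth Y n" for n
  proof (induction n rule: less_induct)
    case (less n)
    then show ?case
      using dse_step_cong[of n X Y graft P] X Y unfolding DSE_def by metis
  qed
  then show "X = Y"
    by (simp add: fps_eq_iff)
qed

lemma DSE_CK_ex1: "\<exists>!X :: 'k::field_char_0 HCK fps. DSE rforest_weight rgraft P X"
  by (rule DSE_ex1) (simp_all add: rforest_weight_def rgraft_def)

lemma DSE_NCK_ex1: "\<exists>!X :: 'k::field_char_0 HNCK fps. DSE pforest_weight pgraft P X"
  by (rule DSE_ex1) (simp_all add: pforest_weight_def pgraft_def zero_list_def plus_list_def)

end

theory Submission
  imports Defs
begin

text \<open>
  Since \<open>P\<^sub>\<alpha>\<^sub>,\<^sub>\<beta>\<close> is \<open>P\<^sub>1\<^sub>,\<^sub>\<beta>\<close> evaluated at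
  \<open>\<alpha>h\<close>, rescaling gives \<open>a\<^sub>n(\<alpha>, \<beta>) = \<alpha>\<^sup>n\<^sup>-\<^sup>1 a\<^sub>n(1, \<beta>)\<close> (lemma
  \<open>solution_rescale\<close>): every vertex of fertility \<open>k\<close> contributes a factor
  \<open>\<alpha>\<^sup>k\<close>, and the fertilities in a tree with \<open>n\<close> vertices add up to
  \<open>n - 1\<close>. Hence for \<open>\<alpha> \<noteq> 0\<close> the generators change only by nonzero scalars,
  and the algebra depends on \<open>\<beta>\<close> alone; for \<open>\<alpha> = 0\<close> the series is
  constant and the algebra is generated by the one-vertex tree.

  Conversely, the parameters can be read off in degrees 2 and 3. A tree is an irreducible element of
  the monoid of forests, so its coefficient in a product \<open>x y\<close> is
  \<open>x\<^sub>0 y\<^sub>t + x\<^sub>t y\<^sub>0\<close>, where the index \<open>0\<close> stands for the empty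
  forest. It follows that the elements satisfying a given homogeneous linear relation between the
  coefficients of two trees form a subalgebra (lemma \<open>subalgebra_tree_relation\<close>). Two such
  relations suffice.
  \<^item> If \<open>\<alpha> = 0\<close>, all generators have coefficient zero at the tree with two vertices,
    whereas the coefficient of \<open>a\<^sub>2(\<alpha>, \<beta>)\<close> there is \<open>\<alpha>\<close>.
  \<^item> All generators satisfy
    \<open>2 x\<^sub>c = (1 + \<beta>) x\<^sub>l\<close>, where \<open>l\<close> is the ladder and \<open>c\<close> the
    cherry with three vertices; \<open>a\<^sub>3(\<alpha>, \<beta>)\<close> has the coefficients
    \<open>\<alpha>\<^sup>2\<close> at \<open>l\<close> and \<open>\<alpha>\<^sup>2 (1 + \<beta>) / 2\<close> at \<open>c\<close>, so for
    \<open>\<alpha> \<noteq> 0\<close> it satisfies the relation of no other \<open>\<beta>'\<close>.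

  The argument uses of forests only a weight and an injective grafting map with irreducible values.
  It is therefore carried out once, in the locale \<open>grafting\<close>, and then applied to rooted and
  to planar rooted trees; both kinds of algebras turn out to coincide under the same condition on the
  parameters.
\<close>

section \<open>Scalars, subalgebras and grafting\<close>

lemma scalar_mult: "scalar c * scalar d = scalar (c * d)"
  by (simp add: scalar_def mult_single)

lemma scalar_scalar_mult: "scalar c * (scalar d * x) = scalar (c * d) * x"
  by (simp only: scalar_mult[symmetric] mult.assoc)

lemma scalar_1: "scalar 1 = 1"
  by (simp add: scalar_def)

lemma lookup_scalar_mult:
  "Poly_Mapping.lookup (scalar c * x) F = c * Poly_Mapping.lookup x F"
  unfolding scalar_def mult_map_scale_conv_mult[symmetric]
  by (simp add: Poly_Mapping.map.rep_eq when_def)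

lemma scalar_commute:
  fixes x :: "'m::monoid_add \<Rightarrow>\<^sub>0 'k::comm_semiring_1"
  shows "x * scalar c = scalar c * x"
proof (induction x rule: update_induct)
  case const
  show ?case by simp
next
  case (update f a b)
  have "Poly_Mapping.update a b f = f + Poly_Mapping.single a b"
    using update.hyps(1)
    by (intro poly_mapping_eqI)
      (auto simp: lookup_update lookup_add lookup_single when_def in_keys_iff)
  with update.IH show ?case
    by (simp add: distrib_left distrib_right scalar_def mult_single mult.commute)
qed

lemma scalar_mult_scalar_mult:
  fixes x y :: "'m::monoid_add \<Rightarrow>\<^sub>0 'k::comm_semiring_1"
  shows "(scalar c * x) * (scalar d * y) = scalar (c * d) * (x * y)"
proof -
  have "(scalar c * x) * (scalar d * y) = scalar c * ((x * scalar d) * y)"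
    by (simp only: mult.assoc)
  then show ?thesis
    by (simp only: scalar_commute[of x] mult.assoc scalar_scalar_mult)
qed

lemma subalgebra_hull: "subalgebra (subalgebra hull S)"
  by (rule hull_in) (auto simp: subalgebra_def)

text \<open>
  With a summation range that may exceed the support, two arguments of \<^const>\<open>bplus\<close> can be
  summed over a common range, which is how linearity is obtained.
\<close>

lemma bplus_superset:
  assumes "finite S" "Poly_Mapping.keys f \<subseteq> S"
  shows "bplus graft f = (\<Sum>F\<in>S. Poly_Mapping.single (graft F) (Poly_Mapping.lookup f F))"
  unfolding bplus_def using assms
  by (intro sum.mono_neutral_left) (auto simp: in_keys_iff)

lemma bplus_add: "bplus graft (f + g) = bplus graft f + bplus graft g"
proof -
  let ?S = "Poly_Mapping.keys f \<union> Poly_Mapping.keys g"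
  have "bplus graft (f + g) =
      (\<Sum>F\<in>?S. Poly_Mapping.single (graft F) (Poly_Mapping.lookup (f + g) F))"
    by (rule bplus_superset) (auto simp: Poly_Mapping.keys_add)
  also have "\<dots> = bplus graft f + bplus graft g"
    by (simp add: bplus_superset[of ?S] lookup_add single_add sum.distrib)
  finally show ?thesis .
qed

lemma bplus_single: "bplus graft (Poly_Mapping.single F c) = Poly_Mapping.single (graft F) c"
  by (subst bplus_superset[of "{F}"]) auto

lemma bplus_scalar: "bplus graft (scalar c * f) = scalar c * bplus graft f"
proof -
  have "Poly_Mapping.keys (scalar c * f) \<subseteq> Poly_Mapping.keys f"
    by (auto simp: in_keys_iff lookup_scalar_mult)
  then have "bplus graft (scalar c * f) = (\<Sum>F\<in>Poly_Mapping.keys f.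
      Poly_Mapping.single (graft F) (c * Poly_Mapping.lookup f F))"
    by (simp add: bplus_superset[of "Poly_Mapping.keys f"] lookup_scalar_mult)
  then show ?thesis
    by (simp add: bplus_def sum_distrib_left scalar_def mult_single)
qed

section \<open>The coefficients of the series\<close>

lemma P_eq_P_series: "P_eq \<alpha> \<beta> (P_series \<alpha> \<beta>)"
  unfolding P_series_def by (rule theI'[OF P_eq_ex1])

lemma P_series_nth_0: "fps_nth (P_series \<alpha> \<beta>) 0 = 1"
  using P_eq_P_series[of \<alpha> \<beta>] by (simp add: P_eq_iff)

lemma P_series_nth_Suc:
  "of_nat (Suc n) * fps_nth (P_series \<alpha> \<beta>) (Suc n) =
     (\<alpha> + \<alpha> * \<beta> * of_nat n) * fps_nth (P_series \<alpha> \<beta>) n"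
  using P_eq_P_series[of \<alpha> \<beta>] unfolding P_eq_iff by blast

lemma P_series_nth_1: "fps_nth (P_series \<alpha> \<beta>) 1 = \<alpha>"
  using P_series_nth_Suc[of 0 \<alpha> \<beta>] by (simp add: P_series_nth_0)

lemma P_series_nth_2: "2 * fps_nth (P_series \<alpha> \<beta>) 2 = \<alpha>\<^sup>2 * (1 + \<beta>)"
  using P_series_nth_Suc[of 1 \<alpha> \<beta>] P_series_nth_1[of \<alpha> \<beta>]
  by (simp add: numeral_2_eq_2 algebra_simps)

text \<open>
  Substituting \<open>\<alpha>h\<close> for \<open>h\<close> in the differential equation for the parameters
  \<open>(1, \<beta>)\<close> gives the one for \<open>(\<alpha>, \<beta>)\<close>.
\<close>

lemma P_series_rescale:
  "fps_nth (P_series \<alpha> \<beta>) k = \<alpha> ^ k * fps_nth (P_series 1 \<beta>) k"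
proof (induction k)
  case 0
  show ?case by (simp add: P_series_nth_0)
next
  case (Suc k)
  have "of_nat (Suc k) * fps_nth (P_series \<alpha> \<beta>) (Suc k) =
      \<alpha> ^ Suc k * ((1 + 1 * \<beta> * of_nat k) * fps_nth (P_series 1 \<beta>) k)"
    unfolding P_series_nth_Suc Suc.IH by (simp add: algebra_simps)
  also have "\<dots> = of_nat (Suc k) * (\<alpha> ^ Suc k * fps_nth (P_series 1 \<beta>) (Suc k))"
    unfolding P_series_nth_Suc[symmetric] by (rule mult.left_commute)
  finally show ?case
    by (simp only: mult_cancel_left of_nat_eq_0_iff) simp
qed

section \<open>Algebras generated by the solution of a Dyson--Schwinger equation\<close>

text \<open>
  The elements of the monoid play the role of forests, and \<open>graft F\<close> that of a forest with a
  single tree. Irreducibility of \<open>graft F\<close> is what distinguishes trees from other forests.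
\<close>

locale grafting =
  fixes wt :: "'m::monoid_add \<Rightarrow> nat" and graft :: "'m \<Rightarrow> 'm"
  assumes wt_0: "wt 0 = 0"
    and wt_add: "wt (F + G) = wt F + wt G"
    and wt_graft: "wt (graft F) = Suc (wt F)"
    and inj_graft: "graft F = graft G \<Longrightarrow> F = G"
    and graft_irreducible: "graft F = G + H \<Longrightarrow> G = 0 \<or> H = 0"
begin

definition solution :: "'k::field_char_0 \<Rightarrow> 'k \<Rightarrow> ('m \<Rightarrow>\<^sub>0 'k) fps" where
  "solution \<alpha> \<beta> = (THE X. DSE wt graft (P_series \<alpha> \<beta>) X)"

definition solution_algebra :: "'k::field_char_0 \<Rightarrow> 'k \<Rightarrow> ('m \<Rightarrow>\<^sub>0 'k) set" where
  "solution_algebra \<alpha> \<beta> = subalgebra hull {fps_nth (solution \<alpha> \<beta>) n |n. n \<ge> 1}"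

lemma graft_neq_0: "graft F \<noteq> 0"
  using wt_graft[of F] wt_0 by auto

text \<open>
  Of all pairs of forests only \<open>(0, graft F)\<close> and \<open>(graft F, 0)\<close> multiply to the tree
  \<open>graft F\<close>. In other words, the coefficient of a tree is a derivation relative to the
  augmentation.
\<close>

lemma lookup_mult_graft:
  fixes x y :: "'m \<Rightarrow>\<^sub>0 'k::semiring_0"
  shows "Poly_Mapping.lookup (x * y) (graft F) =
    Poly_Mapping.lookup x 0 * Poly_Mapping.lookup y (graft F) +
    Poly_Mapping.lookup x (graft F) * Poly_Mapping.lookup y 0"
proof -
  let ?f = "\<lambda>(G, H). (Poly_Mapping.lookup x G * Poly_Mapping.lookup y H when graft F = G + H)"
  have "Poly_Mapping.lookup (x * y) (graft F) = Sum_any ?f"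
    by (simp add: times_poly_mapping.rep_eq prod_fun_unfold_prod)
  also have "\<dots> = sum ?f {(0, graft F), (graft F, 0)}"
    by (rule Sum_any.expand_superset)
      (use graft_irreducible in \<open>force simp: when_def split: if_splits\<close>)+
  finally show ?thesis
    using graft_neq_0[of F] graft_neq_0[of F, symmetric] by (simp add: when_def)
qed

text \<open>
  This is the source of all invariants that separate the algebras: a relation that holds for the
  generators propagates to the whole algebra, because the coefficients of trees vanish at
  \<open>1\<close> and obey the Leibniz rule above.
\<close>

lemma subalgebra_tree_relation:
  fixes c d :: "'k::field"
  shows "subalgebra {x :: 'm \<Rightarrow>\<^sub>0 'k.
    c * Poly_Mapping.lookup x (graft F) = d * Poly_Mapping.lookup x (graft G)}"
proof -
  let ?S = "{x :: 'm \<Rightarrow>\<^sub>0 'k.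
    c * Poly_Mapping.lookup x (graft F) = d * Poly_Mapping.lookup x (graft G)}"
  have "c * (x * yF + xF * y) = d * (x * yG + xG * y)"
    if "c * xF = d * xG" "c * yF = d * yG" for x y xF xG yF yG :: 'k
    using that by algebra
  then have "x * y \<in> ?S" if "x \<in> ?S" "y \<in> ?S" for x y
    using that by (simp add: lookup_mult_graft)
  moreover have "scalar e * x \<in> ?S" if "x \<in> ?S" for e x
    using that by (simp add: lookup_scalar_mult mult.left_commute[of _ e])
  moreover have "x + y \<in> ?S" if "x \<in> ?S" "y \<in> ?S" for x y
    using that by (simp add: lookup_add distrib_left)
  moreover have "1 \<in> ?S"
    by (simp add: lookup_one graft_neq_0)
  ultimately show ?thesis
    unfolding subalgebra_def by blast
qed

lemma DSE_solution: "DSE wt graft (P_series \<alpha> \<beta>) (solution \<alpha> \<beta>)"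
  unfolding solution_def by (rule theI'[OF DSE_ex1[OF wt_0 wt_add wt_graft]])

lemma solution_eqI: "DSE wt graft (P_series \<alpha> \<beta>) X \<Longrightarrow> solution \<alpha> \<beta> = X"
  unfolding solution_def by (rule the1_equality[OF DSE_ex1[OF wt_0 wt_add wt_graft]])

lemma solution_completion: "solution \<alpha> \<beta> \<in> completion wt"
  using DSE_solution[of \<alpha> \<beta>] unfolding DSE_def by blast

lemma solution_nth_0: "fps_nth (solution \<alpha> \<beta>) 0 = 0"
  using DSE_solution[of \<alpha> \<beta>] by (simp add: DSE_def)

lemma solution_nth_Suc:
  "fps_nth (solution \<alpha> \<beta>) (Suc n) =
     bplus graft (\<Sum>k=0..n. scalar (fps_nth (P_series \<alpha> \<beta>) k) * fps_nth (solution \<alpha> \<beta> ^ k) n)"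
proof -
  have "solution \<alpha> \<beta> = bplus_hat graft (fps_subst (P_series \<alpha> \<beta>) (solution \<alpha> \<beta>))"
    using DSE_solution[of \<alpha> \<beta>] unfolding DSE_def by blast
  then have "fps_nth (solution \<alpha> \<beta>) (Suc n) =
      fps_nth (bplus_hat graft (fps_subst (P_series \<alpha> \<beta>) (solution \<alpha> \<beta>))) (Suc n)"
    by metis
  then show ?thesis
    by (simp add: bplus_hat_def fps_subst_def fps_compose_nth)
qed

lemma lookup_solution_eq_0:
  "wt F \<noteq> n \<Longrightarrow> Poly_Mapping.lookup (fps_nth (solution \<alpha> \<beta>) n) F = 0"
  using solution_completion[of \<alpha> \<beta>]
  by (fastforce simp: completion_def homogeneous_def in_keys_iff)

lemma solution_nth_1: "fps_nth (solution \<alpha> \<beta>) 1 = Poly_Mapping.single (graft 0) 1"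
  using solution_nth_Suc[of \<alpha> \<beta> 0] bplus_single[of graft 0 "1::'a"]
  by (simp add: P_series_nth_0 scalar_1)

lemma solution_nth_2: "fps_nth (solution \<alpha> \<beta>) 2 = Poly_Mapping.single (graft (graft 0)) \<alpha>"
  using solution_nth_Suc[of \<alpha> \<beta> 1] P_series_nth_1[of \<alpha> \<beta>] solution_nth_1[of \<alpha> \<beta>]
  by (simp add: numeral_2_eq_2 scalar_def mult_single bplus_single)

lemma solution_nth_3:
  "fps_nth (solution \<alpha> \<beta>) 3 =
     Poly_Mapping.single (graft (graft (graft 0))) (\<alpha>\<^sup>2) +
     Poly_Mapping.single (graft (graft 0 + graft 0)) (fps_nth (P_series \<alpha> \<beta>) 2)"
proof -
  have "fps_nth (solution \<alpha> \<beta> ^ 2) 2 = Poly_Mapping.single (graft 0 + graft 0) 1"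
    using solution_nth_1[of \<alpha> \<beta>]
    by (simp add: power2_eq_square fps_mult_nth numeral_2_eq_2 solution_nth_0 mult_single)
  then show ?thesis
    using solution_nth_Suc[of \<alpha> \<beta> 2] P_series_nth_1[of \<alpha> \<beta>] solution_nth_2[of \<alpha> \<beta>]
    by (simp add: numeral_3_eq_3 numeral_2_eq_2 scalar_def mult_single bplus_add bplus_single)
qed

text \<open>
  The family on the right is shown to solve the equation for \<open>(\<alpha>, \<beta>)\<close>, so that
  uniqueness of the solution applies. If \<open>Y\<close> solves the equation for \<open>(1, \<beta>)\<close>
  and \<open>Z\<close> is the candidate, then \<open>\<alpha> Z\<close> is \<open>Y\<close> with its component of
  degree \<open>n\<close> multiplied by \<open>\<alpha>\<^sup>n\<close>, and this operation is an algebra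
  endomorphism; therefore \<open>P\<^sub>\<alpha>\<^sub>,\<^sub>\<beta>(Z) = P\<^sub>1\<^sub>,\<^sub>\<beta>(\<alpha> Z)\<close> arises from
  \<open>P\<^sub>1\<^sub>,\<^sub>\<beta>(Y)\<close> in the same way. For \<open>\<alpha> = 0\<close> the convention
  \<open>0\<^sup>0 = 1\<close> keeps the component of degree 1.
\<close>

lemma solution_rescale:
  "fps_nth (solution \<alpha> \<beta>) n = scalar (\<alpha> ^ (n - 1)) * fps_nth (solution 1 \<beta>) n"
proof -
  define Y where "Y = solution 1 \<beta>"
  define Z where "Z = Abs_fps (\<lambda>n. scalar (\<alpha> ^ (n - 1)) * fps_nth Y n)"
  have Y0: "fps_nth Y 0 = 0"
    by (simp add: Y_def solution_nth_0)
  \<comment> \<open>In degree 0 the truncated exponent \<open>i - 1\<close> is harmless because \<open>Y\<close> has no constant term.\<close>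
  have Z: "scalar \<alpha> * fps_nth Z i = scalar (\<alpha> ^ i) * fps_nth Y i" for i
    by (cases i) (simp_all add: Z_def Y0 scalar_scalar_mult)
  have Zk: "scalar (\<alpha> ^ k) * fps_nth (Z ^ k) n = scalar (\<alpha> ^ n) * fps_nth (Y ^ k) n" for k n
  proof (induction k arbitrary: n)
    case 0
    show ?case by (simp add: scalar_1)
  next
    case (Suc k)
    have "scalar (\<alpha> ^ Suc k) * (fps_nth Z i * fps_nth (Z ^ k) (n - i)) =
        scalar (\<alpha> ^ n) * (fps_nth Y i * fps_nth (Y ^ k) (n - i))" if "i \<le> n" for i
    proof -
      have "scalar (\<alpha> ^ Suc k) * (fps_nth Z i * fps_nth (Z ^ k) (n - i)) =
          (scalar \<alpha> * fps_nth Z i) * (scalar (\<alpha> ^ k) * fps_nth (Z ^ k) (n - i))"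
        unfolding scalar_mult_scalar_mult power_Suc ..
      also have "\<dots> = scalar (\<alpha> ^ i * \<alpha> ^ (n - i)) * (fps_nth Y i * fps_nth (Y ^ k) (n - i))"
        unfolding Z Suc.IH scalar_mult_scalar_mult ..
      finally show ?thesis
        using that by (simp add: power_add[symmetric])
    qed
    then show ?case
      by (simp add: fps_mult_nth sum_distrib_left)
  qed
  have "fps_nth Z n = fps_nth (bplus_hat graft (fps_subst (P_series \<alpha> \<beta>) Z)) n" for n
  proof (cases n)
    case 0
    then show ?thesis by (simp add: Z_def Y0 bplus_hat_def)
  next
    case (Suc m)
    have "scalar (fps_nth (P_series \<alpha> \<beta>) k) * fps_nth (Z ^ k) m =
        scalar (\<alpha> ^ m) * (scalar (fps_nth (P_series 1 \<beta>) k) * fps_nth (Y ^ k) m)" for k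
    proof -
      have "scalar (fps_nth (P_series \<alpha> \<beta>) k) * fps_nth (Z ^ k) m =
          scalar (fps_nth (P_series 1 \<beta>) k) * (scalar (\<alpha> ^ k) * fps_nth (Z ^ k) m)"
        unfolding P_series_rescale[of \<alpha>] scalar_scalar_mult
        by (simp only: mult.commute)
      also have "\<dots> = scalar (\<alpha> ^ m) * (scalar (fps_nth (P_series 1 \<beta>) k) * fps_nth (Y ^ k) m)"
        unfolding Zk scalar_scalar_mult by (simp only: mult.commute)
      finally show ?thesis .
    qed
    moreover have "fps_nth Z (Suc m) = scalar (\<alpha> ^ m) * fps_nth Y (Suc m)"
      by (simp add: Z_def)
    ultimately show ?thesis
      by (simp add: Suc Y_def
          solution_nth_Suc bplus_hat_def fps_subst_def fps_compose_nth
          sum_distrib_left[symmetric] bplus_scalar)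
  qed
  then have "Z = bplus_hat graft (fps_subst (P_series \<alpha> \<beta>) Z)"
    by (rule fps_ext)
  moreover have "Z \<in> completion wt"
    using solution_completion[of 1 \<beta>]
    by (auto simp: completion_def homogeneous_def in_keys_iff Z_def Y_def lookup_scalar_mult)
  moreover have "fps_nth Z 0 = 0"
    by (simp add: Z_def Y0)
  ultimately have "solution \<alpha> \<beta> = Z"
    by (intro solution_eqI) (unfold DSE_def, blast)
  then show ?thesis
    by (simp add: Z_def Y_def)
qed

lemma solution_in_algebra: "n \<ge> 1 \<Longrightarrow> fps_nth (solution \<alpha> \<beta>) n \<in> solution_algebra \<alpha> \<beta>"
  unfolding solution_algebra_def by (rule hull_inc) blast

lemma solution_algebra_subset:
  assumes "subalgebra S" "\<And>n. n \<ge> 1 \<Longrightarrow> fps_nth (solution \<alpha> \<beta>) n \<in> S"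
  shows "solution_algebra \<alpha> \<beta> \<subseteq> S"
  unfolding solution_algebra_def by (rule hull_minimal) (use assms in auto)

lemma solution_algebra_rescale:
  assumes "\<alpha> \<noteq> 0"
  shows "solution_algebra \<alpha> \<beta> = solution_algebra 1 \<beta>"
proof
  have scale: "scalar c * x \<in> solution_algebra \<gamma> \<beta>" if "x \<in> solution_algebra \<gamma> \<beta>"
    for \<gamma> c :: 'a and x
    using that subalgebra_hull unfolding solution_algebra_def subalgebra_def by blast
  show "solution_algebra \<alpha> \<beta> \<subseteq> solution_algebra 1 \<beta>"
  proof (rule solution_algebra_subset)
    show "subalgebra (solution_algebra 1 \<beta>)"
      unfolding solution_algebra_def by (rule subalgebra_hull)
    show "fps_nth (solution \<alpha> \<beta>) n \<in> solution_algebra 1 \<beta>" if "n \<ge> 1" for n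
      unfolding solution_rescale[of \<alpha>] by (intro scale solution_in_algebra that)
  qed
  show "solution_algebra 1 \<beta> \<subseteq> solution_algebra \<alpha> \<beta>"
  proof (rule solution_algebra_subset)
    show "subalgebra (solution_algebra \<alpha> \<beta>)"
      unfolding solution_algebra_def by (rule subalgebra_hull)
    fix n :: nat
    assume "n \<ge> 1"
    have "fps_nth (solution 1 \<beta>) n =
        scalar (inverse (\<alpha> ^ (n - 1))) * fps_nth (solution \<alpha> \<beta>) n"
      unfolding solution_rescale[of \<alpha>]
      using assms by (simp add: scalar_scalar_mult scalar_1)
    then show "fps_nth (solution 1 \<beta>) n \<in> solution_algebra \<alpha> \<beta>"
      using scale[OF solution_in_algebra[OF \<open>n \<ge> 1\<close>]] by simp
  qed
qed

lemma solution_algebra_0: "solution_algebra 0 \<beta> = solution_algebra 0 \<beta>'"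
proof -
  have "fps_nth (P_series 0 \<beta>) k = fps_nth (P_series 0 \<beta>') k" for k
    by (cases k) (simp_all add: P_series_nth_0 P_series_rescale[of 0])
  then have "P_series 0 \<beta> = P_series 0 \<beta>'"
    by (simp add: fps_eq_iff)
  then show ?thesis
    by (simp add: solution_algebra_def solution_def)
qed

text \<open>
  The tree with two vertices detects \<open>\<alpha>\<close>: its coefficient vanishes on the algebra with
  parameter \<open>0\<close> and equals \<open>\<alpha>\<close> at the generator of degree 2.
\<close>

lemma solution_algebra_subset_0:
  assumes "solution_algebra \<alpha> \<beta> \<subseteq> solution_algebra 0 \<beta>'"
  shows "\<alpha> = 0"
proof -
  \<comment> \<open>The vanishing of a single coefficient is written as a relation with coefficients 1 and 0.\<close>
  define S where "S = {x :: 'm \<Rightarrow>\<^sub>0 'a. 1 * Poly_Mapping.lookup x (graft (graft 0)) =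
    0 * Poly_Mapping.lookup x (graft (graft 0))}"
  have "fps_nth (solution 0 \<beta>') n \<in> S" for n
    by (cases "n = 2")
      (simp_all add: S_def solution_nth_2 lookup_solution_eq_0 wt_graft wt_0)
  moreover have "subalgebra S"
    unfolding S_def by (rule subalgebra_tree_relation)
  ultimately have "solution_algebra 0 \<beta>' \<subseteq> S"
    by (intro solution_algebra_subset)
  with assms have "fps_nth (solution \<alpha> \<beta>) 2 \<in> S"
    using solution_in_algebra[of 2 \<alpha> \<beta>] by auto
  then show ?thesis
    by (simp add: S_def solution_nth_2)
qed

text \<open>
  The generator of degree 3 has \<open>(1 + \<beta>) / 2\<close> times as large a coefficient at the cherry
  with three vertices as at the ladder, and both coefficients vanish at the other generators; so the
  same proportion holds on the whole algebra. It determines \<open>\<beta>\<close> as soon as the coefficient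
  \<open>\<alpha>\<^sup>2\<close> of the ladder is nonzero.
\<close>

lemma solution_algebra_subset_imp_eq:
  assumes "solution_algebra \<alpha> \<beta> \<subseteq> solution_algebra \<alpha>' \<beta>'" "\<alpha> \<noteq> 0"
  shows "\<beta> = \<beta>'"
proof -
  let ?ladder = "graft (graft (graft 0))" and ?cherry = "graft (graft 0 + graft 0)"
  have neq: "?ladder \<noteq> ?cherry"
    using inj_graft graft_irreducible graft_neq_0 by metis
  have coeffs: "Poly_Mapping.lookup (fps_nth (solution \<gamma> \<delta>) 3) ?ladder = \<gamma>\<^sup>2"
    "2 * Poly_Mapping.lookup (fps_nth (solution \<gamma> \<delta>) 3) ?cherry = \<gamma>\<^sup>2 * (1 + \<delta>)" for \<gamma> \<delta> :: 'a
    using neq P_series_nth_2[of \<gamma> \<delta>]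
    by (simp_all add: solution_nth_3 lookup_add lookup_single when_def)
  define S where "S = {x :: 'm \<Rightarrow>\<^sub>0 'a. 2 * Poly_Mapping.lookup x ?cherry =
    (1 + \<beta>') * Poly_Mapping.lookup x ?ladder}"
  have "fps_nth (solution \<alpha>' \<beta>') n \<in> S" for n
    by (cases "n = 3")
      (simp_all add: S_def coeffs lookup_solution_eq_0 wt_graft wt_add wt_0)
  moreover have "subalgebra S"
    unfolding S_def by (rule subalgebra_tree_relation)
  ultimately have "solution_algebra \<alpha>' \<beta>' \<subseteq> S"
    by (intro solution_algebra_subset)
  with assms have "fps_nth (solution \<alpha> \<beta>) 3 \<in> S"
    using solution_in_algebra[of 3 \<alpha> \<beta>] by auto
  then show ?thesis
    using assms(2) by (simp add: S_def coeffs)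
qed

theorem solution_algebra_eq_iff:
  "solution_algebra \<alpha> \<beta> = solution_algebra \<alpha>' \<beta>' \<longleftrightarrow>
     (\<beta> = \<beta>' \<and> \<alpha> * \<alpha>' \<noteq> 0) \<or> (\<alpha> = 0 \<and> \<alpha>' = 0)"
proof
  assume eq: "solution_algebra \<alpha> \<beta> = solution_algebra \<alpha>' \<beta>'"
  have "\<alpha> = 0 \<longleftrightarrow> \<alpha>' = 0"
    using eq solution_algebra_subset_0 by blast
  then show "(\<beta> = \<beta>' \<and> \<alpha> * \<alpha>' \<noteq> 0) \<or> (\<alpha> = 0 \<and> \<alpha>' = 0)"
    using solution_algebra_subset_imp_eq[OF equalityD1[OF eq]] by auto
next
  assume "(\<beta> = \<beta>' \<and> \<alpha> * \<alpha>' \<noteq> 0) \<or> (\<alpha> = 0 \<and> \<alpha>' = 0)"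
  then show "solution_algebra \<alpha> \<beta> = solution_algebra \<alpha>' \<beta>'"
    using solution_algebra_rescale[of \<alpha> \<beta>] solution_algebra_rescale[of \<alpha>' \<beta>']
      solution_algebra_0[of \<beta> \<beta>'] by auto
qed

end

section \<open>Rooted trees and planar rooted trees\<close>

interpretation CK: grafting rforest_weight rgraft
  by unfold_locales (auto simp: rforest_weight_def rgraft_def single_is_union)

interpretation NCK: grafting pforest_weight pgraft
  by unfold_locales
    (auto simp: pforest_weight_def pgraft_def zero_list_def plus_list_def Cons_eq_append_conv)

lemma A_CK_eq_solution_algebra: "A_CK \<alpha> \<beta> = CK.solution_algebra \<alpha> \<beta>"
  by (simp add: A_CK_def CK.solution_algebra_def a_CK_def CK.solution_def)

lemma A_NCK_eq_solution_algebra: "A_NCK \<alpha> \<beta> = NCK.solution_algebra \<alpha> \<beta>"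
  by (simp add: A_NCK_def NCK.solution_algebra_def a_NCK_def NCK.solution_def)

theorem theorem13:
  fixes \<alpha> \<beta> \<alpha>' \<beta>' :: "'k::field_char_0"
  shows "(A_NCK \<alpha> \<beta> = A_NCK \<alpha>' \<beta>' \<longleftrightarrow> A_CK \<alpha> \<beta> = A_CK \<alpha>' \<beta>') \<and>
         (A_CK \<alpha> \<beta> = A_CK \<alpha>' \<beta>' \<longleftrightarrow>
            (\<beta> = \<beta>' \<and> \<alpha> * \<alpha>' \<noteq> 0) \<or> (\<alpha> = 0 \<and> \<alpha>' = 0))"
  by (simp add: A_CK_eq_solution_algebra A_NCK_eq_solution_algebra
      CK.solution_algebra_eq_iff NCK.solution_algebra_eq_iff)

end
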